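(* There exists a hereditary subshift $Y\subset\{0,1\}^{\mathbb{Z}}$ with positive topological entropy $h_{top}(S,Y)>0$ such that the simplex $\mathcal{P}(S,Y)$ of its invariant measures is not Poulsen.
   Context: $S$ denotes the left translation (shift) on $\{0,1\}^{\mathbb{Z}}$. A subshift $Y\subset\{0,1\}^{\mathbb{Z}}$ is a (nonempty) closed set invariant under $S$; it is hereditary if $x\in Y$, $y\in\{0,1\}^{\mathbb{Z}}$ and $y\le x$ coordinatewise imply $y\in Y$. $\mathcal{P}(S,Y)$ is the set of $S$-invariant Borel probability measures on $Y$ with the weak topology (a Choquet simplex whose extreme points are the ergodic measures). A simplex is called Poulsen if it is non-trivial (has more than one point) and its set of extreme points is dense. *)

theory Defs
  imports "HOL-Probability.Probability"
begin

text \<open>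
  The full shift $\{0,1\}^{\mathbb{Z}}$ is the type \<^typ>\<open>int \<Rightarrow> bool\<close> with \<^term>\<open>False\<close> for 0 and
  \<^term>\<open>True\<close> for 1: its library topology is the product of discrete topologies, and its
  library order is the coordinatewise one.
\<close>

definition left_shift :: "(int \<Rightarrow> 'a) \<Rightarrow> (int \<Rightarrow> 'a)" where
  "left_shift x = (\<lambda>n. x (n + 1))"

definition subshift :: "(int \<Rightarrow> bool) set \<Rightarrow> bool" where
  "subshift Y \<longleftrightarrow> Y \<noteq> {} \<and> closed Y \<and> left_shift ` Y = Y"

definition hereditary :: "(int \<Rightarrow> bool) set \<Rightarrow> bool" where
  "hereditary Y \<longleftrightarrow> (\<forall>x\<in>Y. \<forall>y. y \<le> x \<longrightarrow> y \<in> Y)"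


text \<open>
  Topological entropy in the sense of Adler, Konheim and McAndrew, for a continuous self-map \<open>T\<close>
  of a nonempty compact set \<open>Y\<close>.
\<close>

definition open_cover :: "'a::topological_space set \<Rightarrow> 'a set set \<Rightarrow> bool" where
  "open_cover Y \<U> \<longleftrightarrow> (\<forall>U\<in>\<U>. openin (top_of_set Y) U) \<and> \<Union>\<U> = Y"

definition min_subcover_card :: "'a set \<Rightarrow> 'a set set \<Rightarrow> nat" where
  "min_subcover_card Y \<U> = (LEAST k. \<exists>\<V>\<subseteq>\<U>. finite \<V> \<and> card \<V> = k \<and> \<Union>\<V> = Y)"

text \<open>The join of the covers $T^{-i}\mathcal{U}$ of \<open>Y\<close> for $i < n$.\<close>

definition iterated_join :: "('a \<Rightarrow> 'a) \<Rightarrow> 'a set \<Rightarrow> 'a set set \<Rightarrow> nat \<Rightarrow> 'a set set" where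
  "iterated_join T Y \<U> n = {{y\<in>Y. \<forall>i<n. (T ^^ i) y \<in> f i} | f. \<forall>i<n. f i \<in> \<U>}"

text \<open>By subadditivity the upper limit below is a limit.\<close>

definition cover_entropy :: "('a \<Rightarrow> 'a) \<Rightarrow> 'a set \<Rightarrow> 'a set set \<Rightarrow> ereal" where
  "cover_entropy T Y \<U> =
     limsup (\<lambda>n. ereal (ln (real (min_subcover_card Y (iterated_join T Y \<U> n))) / real n))"

definition topological_entropy :: "('a::topological_space \<Rightarrow> 'a) \<Rightarrow> 'a set \<Rightarrow> ereal" where
  "topological_entropy T Y = (SUP \<U>\<in>{\<U>. open_cover Y \<U>}. cover_entropy T Y \<U>)"


definition invariant_measures ::
    "('a::topological_space \<Rightarrow> 'a) \<Rightarrow> 'a set \<Rightarrow> 'a measure set" where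
  "invariant_measures T Y =
     {M. sets M = sets (restrict_space borel Y) \<and> prob_space M \<and> distr M M T = M}"

text \<open>
  The coarsest topology on a set \<open>K\<close> of Borel probability measures on a compact set \<open>Y\<close> making
  $\mu \mapsto \int f\,d\mu$ continuous for every continuous $f : Y \to \mathbb{R}$.
\<close>

definition weak_topology_on ::
    "'a::topological_space set \<Rightarrow> 'a measure set \<Rightarrow> 'a measure topology" where
  "weak_topology_on Y K =
     topology_generated_by
       {{M\<in>K. integral\<^sup>L M f \<in> U} | (f :: 'a \<Rightarrow> real) U. continuous_on Y f \<and> open U}"

text \<open>
  The library's \<^const>\<open>extreme_point_of\<close> needs a real vector space, which the type of measures is
  not, so proper convex combinations of measures are written out setwise.
\<close>

definition extreme_measures :: "'a measure set \<Rightarrow> 'a measure set" where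
  "extreme_measures K =
     {M\<in>K. \<not> (\<exists>M1\<in>K. \<exists>M2\<in>K. \<exists>t::real. M1 \<noteq> M2 \<and> 0 < t \<and> t < 1 \<and>
        (\<forall>A\<in>sets M. measure M A = (1 - t) * measure M1 A + t * measure M2 A))}"

text \<open>
  Only to be applied to topologies whose underlying set is a simplex of probability measures, such
  as the set of all invariant measures of a continuous self-map of a compact metrizable space.
\<close>

definition poulsen :: "'a measure topology \<Rightarrow> bool" where
  "poulsen X \<longleftrightarrow>
     (\<exists>M\<in>topspace X. \<exists>N\<in>topspace X. M \<noteq> N) \<and>
     X closure_of (extreme_measures (topspace X)) = topspace X"

lemma topspace_weak_topology_on: "topspace (weak_topology_on Y K) = K"
proof -
  have "K = {M\<in>K. integral\<^sup>L M (\<lambda>_::'a. 0::real) \<in> UNIV}" by simp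
  then have "K \<in> {{M\<in>K. integral\<^sup>L M f \<in> U} | (f :: 'a \<Rightarrow> real) U. continuous_on Y f \<and> open U}"
    using continuous_on_const open_UNIV by blast
  then show ?thesis
    unfolding weak_topology_on_def topology_generated_by_topspace by blast
qed

end

theory Submission
  imports Defs
begin

text \<open>
  The idea is that a union of two subshifts does not have a Poulsen simplex as soon as some
  invariant measure charges both differences. An extreme invariant measure gives an invariant set measure 0 or 1
  (\<open>extreme_measure_invariant_set\<close>), so on a union $Y_1 \cup Y_2$ of two subshifts it is carried
  by $Y_1$ or by $Y_2$. A cylinder that misses $Y_2$ and a cylinder that misses $Y_1$ then cannot
  both have positive measure for it. Cylinders are clopen, so having positive measure on both of them is a
  weakly open condition; once some invariant measure satisfies it, the extreme points are not dense.

  The pieces used here are $Y_2$ and $Y_3$, where $Y_p$ consists of the sequences whose ones all lie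
  in a single residue class modulo $p$, i.e. the hereditary closure of a periodic orbit. The
  cylinder of sequences with ones at 0 and 2 misses $Y_3$, the one with ones at 0 and 3 misses
  $Y_2$, and half the sum of the two periodic orbit measures charges both cylinders
  (\<open>mixed_orbit_measure\<close>). The entropy is positive because the even coordinates are free in $Y_2$,
  which gives at least $2^{\lfloor n/2\rfloor}$ words of length $n$ (\<open>entropy_residue_union\<close>).
\<close>

section \<open>Sequences supported in one residue class\<close>

definition residue_shift :: "int \<Rightarrow> (int \<Rightarrow> bool) set" where
  "residue_shift p = {x. \<forall>i j. x i \<longrightarrow> x j \<longrightarrow> p dvd i - j}"

lemma clopen_coordinate:
  shows "open {x :: int \<Rightarrow> bool. x i}" and "closed {x :: int \<Rightarrow> bool. x i}"
proof -
  have c: "continuous_on UNIV (\<lambda>x :: int \<Rightarrow> bool. x i)"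
    by (rule continuous_on_product_coordinates)
  have e: "{x :: int \<Rightarrow> bool. x i} = (\<lambda>x. x i) -` {True}" by auto
  show "open {x :: int \<Rightarrow> bool. x i}"
    unfolding e by (rule open_vimage[OF discrete_topology_class.open_discrete c])
  show "closed {x :: int \<Rightarrow> bool. x i}"
    unfolding e by (rule closed_vimage[OF _ c]) simp
qed

lemma closed_residue_shift: "closed (residue_shift p)"
proof -
  have "closed {x :: int \<Rightarrow> bool. x i \<longrightarrow> x j \<longrightarrow> p dvd i - j}" for i j
    by (intro closed_Collect_imp clopen_coordinate closed_Collect_const)
  then show ?thesis
    unfolding residue_shift_def by (intro closed_Collect_all)
qed

lemma left_shift_mem_residue_shift [simp]: "left_shift x \<in> residue_shift p \<longleftrightarrow> x \<in> residue_shift p"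
proof
  assume l: "left_shift x \<in> residue_shift p"
  have "p dvd i - j" if "x i" "x j" for i j
  proof -
    have "left_shift x (i - 1)" "left_shift x (j - 1)"
      using that by (simp_all add: left_shift_def)
    then have "p dvd (i - 1) - (j - 1)"
      using l unfolding residue_shift_def by blast
    then show ?thesis by simp
  qed
  then show "x \<in> residue_shift p" by (simp add: residue_shift_def)
next
  assume x: "x \<in> residue_shift p"
  have "p dvd i - j" if "x (i + 1)" "x (j + 1)" for i j
  proof -
    have "p dvd (i + 1) - (j + 1)" using x that unfolding residue_shift_def by blast
    then show ?thesis by simp
  qed
  then show "left_shift x \<in> residue_shift p"
    by (simp add: residue_shift_def left_shift_def)
qed

lemma surj_left_shift: "surj (left_shift :: (int \<Rightarrow> 'a) \<Rightarrow> _)"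
proof (rule surjI)
  show "left_shift (\<lambda>n. x (n - 1)) = x" for x :: "int \<Rightarrow> 'a"
    by (simp add: left_shift_def)
qed

lemma subshift_residue_union: "subshift (residue_shift p \<union> residue_shift q)"
proof -
  let ?Y = "residue_shift p \<union> residue_shift q"
  have "(\<lambda>_. False) \<in> residue_shift p" by (simp add: residue_shift_def)
  moreover have "left_shift ` ?Y = ?Y"
  proof (intro equalityI subsetI)
    fix x assume x: "x \<in> ?Y"
    obtain y where "x = left_shift y" using surj_left_shift by (metis surjD)
    then show "x \<in> left_shift ` ?Y" using x by auto
  qed auto
  ultimately show ?thesis
    by (auto simp: subshift_def closed_residue_shift)
qed

lemma hereditary_residue_union: "hereditary (residue_shift p \<union> residue_shift q)"
proof -
  have "y \<in> residue_shift r" if "x \<in> residue_shift r" "y \<le> x" for x y r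
    using that by (auto simp: residue_shift_def le_fun_def)
  then show ?thesis unfolding hereditary_def by blast
qed

section \<open>Entropy\<close>

lemma funpow_left_shift: "(left_shift ^^ i) x = (\<lambda>n. x (n + int i))"
  by (induction i) (auto simp: left_shift_def algebra_simps)

lemma finite_iterated_join:
  assumes "finite \<U>"
  shows "finite (iterated_join T Y \<U> n)"
proof -
  have "iterated_join T Y \<U> n \<subseteq>
      (\<lambda>f. {y\<in>Y. \<forall>i<n. (T ^^ i) y \<in> f i}) ` ({..<n} \<rightarrow>\<^sub>E \<U>)"
  proof
    fix W assume "W \<in> iterated_join T Y \<U> n"
    then obtain f where f: "\<forall>i<n. f i \<in> \<U>" "W = {y\<in>Y. \<forall>i<n. (T ^^ i) y \<in> f i}"
      unfolding iterated_join_def by blast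
    have "W = {y\<in>Y. \<forall>i<n. (T ^^ i) y \<in> restrict f {..<n} i}" using f by auto
    moreover have "restrict f {..<n} \<in> {..<n} \<rightarrow>\<^sub>E \<U>" using f by auto
    ultimately show "W \<in> (\<lambda>f. {y\<in>Y. \<forall>i<n. (T ^^ i) y \<in> f i}) ` ({..<n} \<rightarrow>\<^sub>E \<U>)" by blast
  qed
  then show ?thesis
    by (rule finite_subset) (intro finite_imageI finite_PiE finite_lessThan assms)
qed

lemma Union_iterated_join:
  assumes "\<Union>\<U> = Y" and "\<And>y. y \<in> Y \<Longrightarrow> T y \<in> Y"
  shows "\<Union>(iterated_join T Y \<U> n) = Y"
proof (intro equalityI subsetI)
  fix y assume y: "y \<in> Y"
  have "(T ^^ i) y \<in> Y" for i
    by (induction i) (simp_all add: y assms(2))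
  then have "\<forall>i. \<exists>U\<in>\<U>. (T ^^ i) y \<in> U" using assms(1) by blast
  then obtain f where "\<forall>i. f i \<in> \<U> \<and> (T ^^ i) y \<in> f i" by metis
  then have "y \<in> {y\<in>Y. \<forall>i<n. (T ^^ i) y \<in> f i}"
    and "{y\<in>Y. \<forall>i<n. (T ^^ i) y \<in> f i} \<in> iterated_join T Y \<U> n"
    using y unfolding iterated_join_def by blast+
  then show "y \<in> \<Union>(iterated_join T Y \<U> n)" by blast
qed (auto simp: iterated_join_def)

text \<open>A set of points that the cover separates pairwise needs one member of a subcover each.\<close>

lemma min_subcover_card_ge:
  assumes "finite \<U>" "\<Union>\<U> = Y" and "g ` I \<subseteq> Y"
    and sep: "\<And>U a b. U \<in> \<U> \<Longrightarrow> a \<in> I \<Longrightarrow> b \<in> I \<Longrightarrow> g a \<in> U \<Longrightarrow> g b \<in> U \<Longrightarrow> a = b"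
  shows "card I \<le> min_subcover_card Y \<U>"
proof -
  have "\<exists>k. \<exists>\<V>\<subseteq>\<U>. finite \<V> \<and> card \<V> = k \<and> \<Union>\<V> = Y"
    using assms(1,2) by blast
  then have "\<exists>\<V>\<subseteq>\<U>. finite \<V> \<and> card \<V> = min_subcover_card Y \<U> \<and> \<Union>\<V> = Y"
    unfolding min_subcover_card_def by (rule LeastI_ex)
  then obtain \<V> where V: "\<V> \<subseteq> \<U>" "finite \<V>" "card \<V> = min_subcover_card Y \<U>" "\<Union>\<V> = Y"
    by blast
  have "\<forall>a\<in>I. \<exists>U\<in>\<V>. g a \<in> U" using V(4) assms(3) by blast
  then obtain h where h: "\<And>a. a \<in> I \<Longrightarrow> h a \<in> \<V> \<and> g a \<in> h a" by metis
  have "inj_on h I"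
    using h sep V(1) by (metis (no_types, lifting) inj_onI subsetD)
  then have "card I \<le> card \<V>"
    using h V(2) by (intro card_inj_on_le) auto
  then show ?thesis using V(3) by simp
qed

lemma entropy_residue_union: "0 < topological_entropy left_shift (residue_shift 2 \<union> residue_shift q)"
proof -
  define Y where "Y = residue_shift 2 \<union> residue_shift q"
  define \<U> where "\<U> = {Y \<inter> {x. x 0}, Y \<inter> - {x. x 0}}"
  have U: "finite \<U>" "\<Union>\<U> = Y" by (auto simp: \<U>_def)
  have U0: "a 0 = b 0" if V: "V \<in> \<U>" "a \<in> V" "b \<in> V" for V a b
  proof -
    consider "V = Y \<inter> {x. x 0}" | "V = Y \<inter> - {x. x 0}"
      using V(1) unfolding \<U>_def by blast
    then show ?thesis using V(2,3) by cases simp_all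
  qed
  have "open_cover Y \<U>"
    unfolding open_cover_def
  proof (intro conjI ballI)
    fix V assume "V \<in> \<U>"
    then consider "V = Y \<inter> {x. x 0}" | "V = Y \<inter> - {x. x 0}" unfolding \<U>_def by blast
    then show "openin (top_of_set Y) V"
      using openin_open_Int[OF clopen_coordinate(1)] openin_open_Int[OF open_Compl[OF clopen_coordinate(2)]]
      by cases (simp_all only:)
  qed (rule U(2))
  \<comment> \<open>The coordinates \<open>0, 2, 4, \<dots>\<close> below \<open>n\<close> are filled in arbitrarily.\<close>
  have card: "2 ^ (n div 2) \<le> min_subcover_card Y (iterated_join left_shift Y \<U> n)" for n
  proof -
    define g :: "nat set \<Rightarrow> int \<Rightarrow> bool" where "g = (\<lambda>A m. \<exists>k\<in>A. m = 2 * int k)"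
    have gk: "g A (2 * int k) \<longleftrightarrow> k \<in> A" for A k by (auto simp: g_def)
    have "card (Pow {..<n div 2}) \<le> min_subcover_card Y (iterated_join left_shift Y \<U> n)"
    proof (rule min_subcover_card_ge)
      show "finite (iterated_join left_shift Y \<U> n)" by (rule finite_iterated_join[OF U(1)])
      show "\<Union>(iterated_join left_shift Y \<U> n) = Y"
        by (rule Union_iterated_join[OF U(2)]) (auto simp: Y_def)
      show "g ` Pow {..<n div 2} \<subseteq> Y"
        by (auto simp: Y_def g_def residue_shift_def)
    next
      fix W A B
      assume W: "W \<in> iterated_join left_shift Y \<U> n" "g A \<in> W" "g B \<in> W"
        and AB: "A \<in> Pow {..<n div 2}" "B \<in> Pow {..<n div 2}"
      obtain f where f: "\<forall>i<n. f i \<in> \<U>" "W = {y\<in>Y. \<forall>i<n. (left_shift ^^ i) y \<in> f i}"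
        using W(1) unfolding iterated_join_def by blast
      have same: "g A (int i) = g B (int i)" if "i < n" for i
      proof -
        have "f i \<in> \<U>" "(left_shift ^^ i) (g A) \<in> f i" "(left_shift ^^ i) (g B) \<in> f i"
          using that f W by auto
        then have "(left_shift ^^ i) (g A) 0 = (left_shift ^^ i) (g B) 0" by (rule U0)
        then show ?thesis by (simp add: funpow_left_shift)
      qed
      have "k \<in> A \<longleftrightarrow> k \<in> B" if "k < n div 2" for k
        using same[of "2 * k"] that gk[of A k] gk[of B k] by auto
      then show "A = B" using AB by (auto simp: Pow_def)
    qed
    then show ?thesis by (simp add: card_Pow)
  qed
  have bound: "ln 2 / 3 \<le> ln (real (min_subcover_card Y (iterated_join left_shift Y \<U> n))) / real n"
    if n: "2 \<le> n" for n
  proof -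
    have "n \<le> 3 * (n div 2)" using n by presburger
    then have "real n \<le> real (3 * (n div 2))" by (simp only: of_nat_le_iff)
    then have "real n / 3 \<le> real (n div 2)" by simp
    then have "ln 2 * (real n / 3) \<le> ln 2 * real (n div 2)" by (intro mult_left_mono) auto
    also have "\<dots> = ln (real (2 ^ (n div 2)))" by (simp add: ln_realpow)
    also have "\<dots> \<le> ln (real (min_subcover_card Y (iterated_join left_shift Y \<U> n)))"
    proof (rule ln_mono)
      show "0 < real (2 ^ (n div 2))" by simp
      show "real (2 ^ (n div 2)) \<le> real (min_subcover_card Y (iterated_join left_shift Y \<U> n))"
        using card[of n] by (simp only: of_nat_le_iff)
    qed
    finally show ?thesis using n by (simp add: field_simps)
  qed
  have "(0::ereal) < ereal (ln 2 / 3)" by simp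
  also have "\<dots> \<le> cover_entropy left_shift Y \<U>"
    unfolding cover_entropy_def
  proof (rule le_Limsup)
    show "\<forall>\<^sub>F n in sequentially. ereal (ln 2 / 3)
        \<le> ereal (ln (real (min_subcover_card Y (iterated_join left_shift Y \<U> n))) / real n)"
      by (rule eventually_sequentiallyI[of 2]) (use bound in \<open>blast intro: ereal_less_eq(3)[THEN iffD2]\<close>)
  qed simp
  also have "\<dots> \<le> topological_entropy left_shift Y"
    unfolding topological_entropy_def using \<open>open_cover Y \<U>\<close> by (intro SUP_upper) auto
  finally show ?thesis unfolding Y_def .
qed

section \<open>Extreme invariant measures and invariant sets\<close>

lemma uniform_measure_invariant:
  assumes M: "M \<in> invariant_measures T Y" and T: "T \<in> measurable M M"
    and A: "A \<in> sets M" and inv: "\<And>x. x \<in> space M \<Longrightarrow> T x \<in> A \<longleftrightarrow> x \<in> A"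
    and pos: "emeasure M A \<noteq> 0"
  shows "uniform_measure M A \<in> invariant_measures T Y"
proof -
  interpret prob_space M using M by (simp add: invariant_measures_def)
  let ?U = "uniform_measure M A"
  have s: "sets ?U = sets M" and sp: "space ?U = space M" by simp_all
  have TU: "T \<in> measurable ?U ?U"
    using T by (simp add: measurable_cong_sets[OF s s])
  have "distr ?U ?U T = ?U"
  proof (rule measure_eqI)
    fix B assume "B \<in> sets (distr ?U ?U T)"
    then have B: "B \<in> sets M" by simp
    have TB: "T -` B \<inter> space M \<in> sets M" using T B by (rule measurable_sets)
    have e: "A \<inter> (T -` B \<inter> space M) = T -` (A \<inter> B) \<inter> space M"
      using inv sets.sets_into_space[OF A] by auto
    have "emeasure M (T -` (A \<inter> B) \<inter> space M) = emeasure (distr M M T) (A \<inter> B)"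
      using T A B by (simp add: emeasure_distr)
    also have "\<dots> = emeasure M (A \<inter> B)" using M by (simp add: invariant_measures_def)
    finally have "emeasure M (T -` (A \<inter> B) \<inter> space M) = emeasure M (A \<inter> B)" .
    then show "emeasure (distr ?U ?U T) B = emeasure ?U B"
      using B TB A e by (simp add: emeasure_distr[OF TU])
  qed simp
  moreover have "prob_space ?U"
    using pos by (rule prob_space_uniform_measure) simp
  ultimately show ?thesis using M by (simp add: invariant_measures_def)
qed

text \<open>
  Otherwise the measure is a proper convex combination of its two conditional measures, on the
  invariant set and on its complement.
\<close>

lemma extreme_measure_invariant_set:
  assumes ext: "M \<in> extreme_measures (invariant_measures T Y)" and T: "T \<in> measurable M M"
    and A: "A \<in> sets M" and inv: "\<And>x. x \<in> space M \<Longrightarrow> T x \<in> A \<longleftrightarrow> x \<in> A"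
  shows "measure M A = 0 \<or> measure M A = 1"
proof (rule ccontr)
  assume not01: "\<not> (measure M A = 0 \<or> measure M A = 1)"
  have M: "M \<in> invariant_measures T Y" using ext by (simp add: extreme_measures_def)
  interpret prob_space M using M by (simp add: invariant_measures_def)
  define C where "C = space M - A"
  have C: "C \<in> sets M" using A by (simp add: C_def)
  have mC: "measure M C = 1 - measure M A" using A by (simp add: C_def prob_compl)
  have a: "0 < measure M A" "measure M A < 1"
    using not01 prob_le_1[of A] measure_nonneg[of M A] by linarith+
  have nzA: "emeasure M A \<noteq> 0" and nzC: "emeasure M C \<noteq> 0"
    using a mC by (auto simp: emeasure_eq_measure)
  have invC: "T x \<in> C \<longleftrightarrow> x \<in> C" if "x \<in> space M" for x
    using inv[OF that] measurable_space[OF T that] that by (auto simp: C_def)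
  have UA: "uniform_measure M A \<in> invariant_measures T Y"
    by (rule uniform_measure_invariant[OF M T A inv nzA])
  have UC: "uniform_measure M C \<in> invariant_measures T Y"
    by (rule uniform_measure_invariant[OF M T C invC nzC])
  have mUA: "measure (uniform_measure M A) B = measure M (A \<inter> B) / measure M A"
    if "B \<in> sets M" for B using that nzA by (intro measure_uniform_measure) auto
  have mUC: "measure (uniform_measure M C) B = measure M (C \<inter> B) / measure M C"
    if "B \<in> sets M" for B using that nzC by (intro measure_uniform_measure) auto
  have "C \<inter> A = {}" by (auto simp: C_def)
  then have "measure (uniform_measure M A) A \<noteq> measure (uniform_measure M C) A"
    using mUA[OF A] mUC[OF A] a by simp
  then have ne: "uniform_measure M A \<noteq> uniform_measure M C" by metis
  have conv: "measure M B = (1 - measure M C) * measure (uniform_measure M A) B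
      + measure M C * measure (uniform_measure M C) B" if B: "B \<in> sets M" for B
  proof -
    have "B = (A \<inter> B) \<union> (C \<inter> B)" using sets.sets_into_space[OF B] by (auto simp: C_def)
    moreover have "measure M ((A \<inter> B) \<union> (C \<inter> B)) = measure M (A \<inter> B) + measure M (C \<inter> B)"
      using A B C by (intro finite_measure_Union) (auto simp: C_def)
    ultimately show ?thesis using mUA[OF B] mUC[OF B] a mC by simp
  qed
  have "0 < measure M C" "measure M C < 1" using a mC by auto
  then show False
    using ext UA UC ne conv unfolding extreme_measures_def by blast
qed

section \<open>Invariant measures on the union\<close>

lemma measurable_left_shift:
  assumes "left_shift ` Y \<subseteq> Y"
  shows "left_shift \<in> measurable (restrict_space borel Y) (restrict_space borel (Y :: (int \<Rightarrow> bool) set))"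
proof -
  have "continuous_on UNIV (left_shift :: (int \<Rightarrow> bool) \<Rightarrow> _)"
    unfolding left_shift_def
    by (intro continuous_on_coordinatewise_then_product continuous_on_product_coordinates)
  then have "left_shift \<in> borel_measurable (borel :: (int \<Rightarrow> bool) measure)"
    by (rule borel_measurable_continuous_onI)
  then show ?thesis
    using assms by (intro measurable_restrict_space3) auto
qed

text \<open>
  The points $\{n : p \mid n + i\}$ for $0 \le i < 6$ run through the orbit of the $p$-periodic
  point the same number of times each when $p \mid 6$; the common range makes both orbits images
  of one rotation of \<open>{0..<6}\<close>.
\<close>

lemma mixed_orbit_measure:
  fixes Y :: "(int \<Rightarrow> bool) set"
  defines "Y \<equiv> residue_shift 2 \<union> residue_shift 3"
  obtains N where "N \<in> invariant_measures left_shift Y"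
    and "0 < measure N {x\<in>Y. x 0 \<and> x 2}" and "0 < measure N {x\<in>Y. x 0 \<and> x 3}"
proof
  define I :: "(int \<times> int) set" where "I = {2,3} \<times> {0..<6}"
  define g :: "int \<times> int \<Rightarrow> int \<Rightarrow> bool" where
    "g = (\<lambda>(p, i) n. (p = 2 \<or> p = 3) \<and> p dvd n + i)"
  define r :: "int \<times> int \<Rightarrow> int \<times> int" where "r = (\<lambda>(p, i). (p, (i + 1) mod 6))"
  define R where "R = restrict_space borel Y"
  define P where "P = pmf_of_set I"
  define N where "N = distr (measure_pmf P) R g"
  have I: "finite I" "I \<noteq> {}" by (auto simp: I_def)
  have gY: "g a \<in> Y" for a
  proof -
    have "p dvd i - j" if "p dvd i + c" "p dvd j + c" for p i j c :: int
      using dvd_diff[OF that] by simp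
    then show ?thesis by (cases a) (auto simp: Y_def g_def residue_shift_def)
  qed
  have gm: "g \<in> measurable (measure_pmf P) R"
    using gY by (intro measurableI) (auto simp: R_def space_restrict_space)
  have Lm: "left_shift \<in> measurable R R"
    unfolding R_def by (rule measurable_left_shift) (auto simp: Y_def)
  have "bij_betw r I I"
  proof (rule bij_betwI[where g = "\<lambda>(p, i). (p, (i - 1) mod 6)"])
    show "(\<lambda>(p, i). (p, (i - 1) mod 6)) (r a) = a" if "a \<in> I" for a
      using that by (auto simp: I_def r_def mod_simps)
    show "r ((\<lambda>(p, i). (p, (i - 1) mod 6)) a) = a" if "a \<in> I" for a
      using that by (auto simp: I_def r_def mod_simps)
  qed (auto simp: I_def r_def)
  then have rP: "map_pmf r P = P"
    unfolding P_def using I by (intro map_pmf_of_set_bij_betw) auto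
  have shift: "left_shift (g a) = g (r a)" for a
  proof -
    have step: "p dvd n + 1 + i \<longleftrightarrow> p dvd n + (i + 1) mod 6" if "p dvd 6" for p n i :: int
    proof -
      have "(n + (i + 1) mod 6) mod p = (n + (i + 1) mod 6 mod p) mod p"
        by (simp add: mod_add_right_eq)
      also have "(i + 1) mod 6 mod p = (i + 1) mod p" using that by (rule mod_mod_cancel)
      also have "(n + (i + 1) mod p) mod p = (n + 1 + i) mod p"
        by (simp add: mod_add_right_eq algebra_simps)
      finally show ?thesis by (simp add: dvd_eq_mod_eq_0)
    qed
    obtain p i where a: "a = (p, i)" by (cases a)
    have "left_shift (g (p, i)) n = g (r (p, i)) n" for n
    proof (cases "p = 2 \<or> p = 3")
      case True
      then have "p dvd 6" by auto
      with True show ?thesis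
        by (simp only: g_def r_def left_shift_def prod.case step)
    qed (simp add: g_def r_def left_shift_def)
    then show ?thesis unfolding a by (rule ext)
  qed
  have "distr N R left_shift = distr (measure_pmf P) R (left_shift \<circ> g)"
    unfolding N_def by (rule distr_distr[OF Lm gm])
  also have "left_shift \<circ> g = g \<circ> r" using shift by auto
  also have "distr (measure_pmf P) R (g \<circ> r) = distr (measure_pmf (map_pmf r P)) R g"
    unfolding map_pmf_rep_eq by (subst distr_distr) (use gY in \<open>auto simp: R_def space_restrict_space\<close>)
  finally have inv: "distr N R left_shift = N" by (simp add: rP N_def)
  have NR: "sets N = sets R" by (simp add: N_def)
  have "distr N N left_shift = N" using inv distr_cong[OF refl NR] by metis
  moreover have "prob_space N"
    unfolding N_def by (rule prob_space.prob_space_distr[OF prob_space_measure_pmf gm])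
  ultimately show "N \<in> invariant_measures left_shift Y"
    by (simp add: invariant_measures_def NR R_def)
  have pos: "0 < measure N B" if B: "B \<in> sets R" "a \<in> I" "g a \<in> B" for B a
  proof -
    have "a \<in> set_pmf P" using that I by (simp add: P_def)
    then have "0 < measure (measure_pmf P) {a}" by (simp add: measure_pmf_single pmf_positive)
    also have "\<dots> \<le> measure (measure_pmf P) (g -` B)"
      using that by (intro measure_pmf.finite_measure_mono) auto
    also have "\<dots> = measure N B" using B by (simp add: N_def measure_distr[OF gm])
    finally show ?thesis .
  qed
  have B: "{x\<in>Y. x 0 \<and> x j} \<in> sets R" for j
  proof -
    have "closed {x :: int \<Rightarrow> bool. x 0 \<and> x j}" by (intro closed_Collect_conj clopen_coordinate)
    then have "{x :: int \<Rightarrow> bool. x 0 \<and> x j} \<in> sets borel" by simp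
    moreover have "{x\<in>Y. x 0 \<and> x j} = Y \<inter> {x. x 0 \<and> x j}" by blast
    ultimately show ?thesis unfolding R_def sets_restrict_space by (rule image_eqI[rotated])
  qed
  show "0 < measure N {x\<in>Y. x 0 \<and> x 2}"
    by (rule pos[of _ "(2, 0)"]) (use B gY[of "(2,0)"] in \<open>auto simp: I_def g_def\<close>)
  show "0 < measure N {x\<in>Y. x 0 \<and> x 3}"
    by (rule pos[of _ "(3, 0)"]) (use B gY[of "(3,0)"] in \<open>auto simp: I_def g_def\<close>)
qed

lemma openin_positive_cylinder:
  fixes Y :: "(int \<Rightarrow> bool) set"
  assumes K: "\<And>M. M \<in> K \<Longrightarrow> sets M = sets (restrict_space borel Y)"
  shows "openin (weak_topology_on Y K) {M\<in>K. 0 < measure M {x\<in>Y. x i \<and> x j}}"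
proof -
  define B where "B = {x :: int \<Rightarrow> bool. x i \<and> x j}"
  have clo: "open B" "closed B"
    unfolding B_def by (auto intro: open_Collect_conj closed_Collect_conj clopen_coordinate)
  have "continuous_on (B \<union> - B) (\<lambda>x. if x \<in> B then 1 else 0 :: real)"
    using clo by (intro continuous_on_cases continuous_on_const) auto
  then have "continuous_on UNIV (indicator B :: _ \<Rightarrow> real)"
    by (simp add: indicator_def of_bool_def)
  then have f: "continuous_on Y (indicator B :: _ \<Rightarrow> real)"
    by (rule continuous_on_subset) simp
  have "integral\<^sup>L M (indicator B :: _ \<Rightarrow> real) = measure M {x\<in>Y. x i \<and> x j}" if "M \<in> K" for M
  proof -
    have "space M = Y" using sets_eq_imp_space_eq[OF K[OF that]] by (simp add: space_restrict_space)
    then have "B \<inter> space M = {x\<in>Y. x i \<and> x j}" by (auto simp: B_def)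
    then show ?thesis by (simp add: Bochner_Integration.integral_indicator)
  qed
  then have "{M\<in>K. 0 < measure M {x\<in>Y. x i \<and> x j}}
      = {M\<in>K. integral\<^sup>L M (indicator B :: _ \<Rightarrow> real) \<in> {0<..}}" by auto
  moreover have "open {0 :: real <..}" by (rule open_greaterThan)
  ultimately show ?thesis
    unfolding weak_topology_on_def using f
    by (intro topology_generated_by_Basis) blast
qed

theorem mainTheorem5:
  "\<exists>Y :: (int \<Rightarrow> bool) set.
     subshift Y \<and> hereditary Y \<and>
     topological_entropy left_shift Y > 0 \<and>
     \<not> poulsen (weak_topology_on Y (invariant_measures left_shift Y))"
proof -
  define Y where "Y = residue_shift 2 \<union> residue_shift 3"
  define K where "K = invariant_measures left_shift Y"
  define W where "W = weak_topology_on Y K"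
  have topW: "topspace W = K" by (simp add: W_def topspace_weak_topology_on)
  define G where "G = {M\<in>K. 0 < measure M {x\<in>Y. x 0 \<and> x 2}} \<inter> {M\<in>K. 0 < measure M {x\<in>Y. x 0 \<and> x 3}}"
  have "openin W G"
    unfolding G_def W_def
    by (intro openin_Int openin_positive_cylinder) (auto simp: K_def invariant_measures_def)
  obtain N where N: "N \<in> K" "N \<in> G"
    using mixed_orbit_measure unfolding G_def K_def Y_def by blast
  have "M \<notin> G" if M: "M \<in> extreme_measures K" for M
  proof
    assume MG: "M \<in> G"
    have MK: "M \<in> invariant_measures left_shift Y"
      using M by (simp add: extreme_measures_def K_def)
    interpret prob_space M using MK by (simp add: invariant_measures_def)
    have sM: "sets M = sets (restrict_space borel Y)"
      using MK by (simp add: invariant_measures_def)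
    have spM: "space M = Y" using sets_eq_imp_space_eq[OF sM] by (simp add: space_restrict_space)
    have meas: "residue_shift p \<inter> Y \<in> sets M" for p
    proof -
      have "residue_shift p \<in> sets borel" using closed_residue_shift by simp
      moreover have "residue_shift p \<inter> Y = Y \<inter> residue_shift p" by blast
      ultimately show ?thesis unfolding sM sets_restrict_space by (rule image_eqI[rotated])
    qed
    have "left_shift \<in> measurable M M"
      unfolding measurable_cong_sets[OF sM sM]
      by (rule measurable_left_shift) (auto simp: Y_def)
    moreover have "left_shift x \<in> residue_shift 2 \<inter> Y \<longleftrightarrow> x \<in> residue_shift 2 \<inter> Y" for x
      by (simp add: Y_def)
    ultimately have "measure M (residue_shift 2 \<inter> Y) = 0 \<or> measure M (residue_shift 2 \<inter> Y) = 1"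
      using extreme_measure_invariant_set[OF M[unfolded K_def] _ meas] by blast
    \<comment> \<open>Each cylinder lies in the part of \<open>Y\<close> outside the subshift that it misses.\<close>
    then show False
    proof
      assume "measure M (residue_shift 2 \<inter> Y) = 0"
      moreover have "measure M {x\<in>Y. x 0 \<and> x 2} \<le> measure M (residue_shift 2 \<inter> Y)"
      proof (rule finite_measure_mono[OF _ meas])
        have "x \<notin> residue_shift 3" if "x 0" "x 2" for x
        proof
          assume "x \<in> residue_shift 3"
          then have "(3::int) dvd 2 - 0" using that unfolding residue_shift_def by blast
          then show False by simp
        qed
        then show "{x\<in>Y. x 0 \<and> x 2} \<subseteq> residue_shift 2 \<inter> Y" by (auto simp: Y_def)
      qed
      ultimately show False using MG by (simp add: G_def)
    next
      assume "measure M (residue_shift 2 \<inter> Y) = 1"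
      then have "measure M (space M - residue_shift 2 \<inter> Y) = 0"
        using prob_compl[OF meas] by simp
      moreover have "measure M {x\<in>Y. x 0 \<and> x 3} \<le> measure M (space M - residue_shift 2 \<inter> Y)"
      proof (rule finite_measure_mono)
        have "x \<notin> residue_shift 2" if "x 0" "x 3" for x
        proof
          assume "x \<in> residue_shift 2"
          then have "(2::int) dvd 3 - 0" using that unfolding residue_shift_def by blast
          then show False by simp
        qed
        then show "{x\<in>Y. x 0 \<and> x 3} \<subseteq> space M - residue_shift 2 \<inter> Y" by (auto simp: spM)
        show "space M - residue_shift 2 \<inter> Y \<in> sets M" using meas by auto
      qed
      ultimately show False using MG by (simp add: G_def)
    qed
  qed
  then have "N \<notin> W closure_of (extreme_measures K)"
    using N(2) \<open>openin W G\<close> by (auto simp: in_closure_of)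
  then have "\<not> poulsen W"
    using N(1) unfolding poulsen_def topW by blast
  then show ?thesis
    using subshift_residue_union hereditary_residue_union entropy_residue_union
    unfolding W_def K_def Y_def by blast
qed

end
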